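(* Let $n \in \mathbb{N}$, $i \in \{1,\dots,n\}$ and let $g \colon I^n \to \mathbb{R}$ be a continuous function. Then: (i) $\mathsf{Sep}_i(g) = \emptyset$ if and only if $\mathsf{Conn}_i(g)$ is a compact interval; (ii) $\mathsf{Conn}_i(g) = \emptyset$ if and only if $\mathsf{Sep}_i(g)$ is a compact interval; (iii) $|\mathsf{Sep}_i(g)| = 1 \iff |\mathsf{Conn}_i(g)| = 1 \iff \mathsf{Sep}_i(g) = \mathsf{Conn}_i(g)$.
   Context: $I^n = [0,1]^n$; for $i \in \{1,\dots,n\}$, $I^n_{i,-} = \{z \in I^n : z_i = 0\}$ and $I^n_{i,+} = \{z \in I^n : z_i = 1\}$. A subset $A \subset I^n$ connects $i$th opposite faces of $I^n$ if there is a connected subset $S \subset A$ with $S \cap I^n_{i,-} \ne \emptyset \ne S \cap I^n_{i,+}$; $A$ separates $i$th opposite faces of $I^n$ if $I^n \setminus A$ does not connect $i$th opposite faces of $I^n$. For a continuous $g \colon I^n \to \mathbb{R}$, $\mathsf{Conn}_i(g)$ (resp. $\mathsf{Sep}_i(g)$) is the set of all $p \in \mathbb{R}$ such that $g^{-1}[\{p\}]$ connects (resp. separates) $i$th opposite faces of $I^n$. "Compact interval" means a nondegenerate compact interval $[a,b]$ with $a<b$. $|X|$ denotes cardinality. *)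

theory Defs
  imports "HOL-Analysis.Analysis"
begin

definition unit_cube :: "(real ^ 'n) set" where
  "unit_cube = cbox 0 1"

definition face_minus :: "'n \<Rightarrow> (real ^ 'n) set" where
  "face_minus i = {z \<in> unit_cube. z $ i = 0}"

definition face_plus :: "'n \<Rightarrow> (real ^ 'n) set" where
  "face_plus i = {z \<in> unit_cube. z $ i = 1}"

(* Intended for subsets A of the unit cube. *)
definition connects_faces :: "'n \<Rightarrow> (real ^ 'n) set \<Rightarrow> bool" where
  "connects_faces i A \<longleftrightarrow>
     (\<exists>S \<subseteq> A. connected S \<and> S \<inter> face_minus i \<noteq> {} \<and> S \<inter> face_plus i \<noteq> {})"

definition separates_faces :: "'n \<Rightarrow> (real ^ 'n) set \<Rightarrow> bool" where
  "separates_faces i A \<longleftrightarrow> \<not> connects_faces i (unit_cube - A)"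

(* A function on the cube is modelled by a total function g whose values off the
   cube are irrelevant, so fibres are intersected with the cube. *)
definition fibre :: "(real ^ 'n \<Rightarrow> real) \<Rightarrow> real \<Rightarrow> (real ^ 'n) set" where
  "fibre g p = {z \<in> unit_cube. g z = p}"

definition Conn :: "'n \<Rightarrow> (real ^ 'n \<Rightarrow> real) \<Rightarrow> real set" where
  "Conn i g = {p. connects_faces i (fibre g p)}"

definition Sep :: "'n \<Rightarrow> (real ^ 'n \<Rightarrow> real) \<Rightarrow> real set" where
  "Sep i g = {p. separates_faces i (fibre g p)}"

(* Nondegenerate: a single point does not count. *)
definition compact_interval :: "real set \<Rightarrow> bool" where
  "compact_interval X \<longleftrightarrow> (\<exists>a b. a < b \<and> X = {a..b})"

end

(* The set of levels p for which {g > p} connects the faces is an open ray below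
   some a, and the set of p for which {g < p} connects them is an open ray above
   some b.  A connected set avoiding the level p lies in {g > p} or in {g < p}, so
   Sep = [a, b].  Clearly Conn is contained in [b, a].  Conversely, if the fibre
   over p does not connect the faces, then unicoherence of the cube yields a
   connected compact set T, disjoint from the fibre, that meets every connected
   set joining the faces.  By connectedness g < p on T or g > p on T; say g < p.
   With q = max g(T), every connected set joining the faces contains a point where
   g is at most q, so a <= q < p.  Hence Conn = [b, a], and all claims are read
   off from the two intervals. *)
theory Submission
  imports Defs
begin

section \<open>Connected separators in compact convex sets\<close>

text \<open>In a compact Hausdorff space components and quasi-components coincide, so two closed
  parts of \<open>K\<close> that no connected subset of \<open>K\<close> joins lie in complementary
  clopen pieces of \<open>K\<close>.\<close>

lemma compact_split_between:
  fixes K :: "'a::euclidean_space set"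
  assumes "compact K" "closed A" "closed B"
    and nocon: "\<And>S. \<lbrakk>connected S; S \<subseteq> K; S \<inter> A \<noteq> {}\<rbrakk> \<Longrightarrow> S \<inter> B = {}"
  obtains C D where "closed C" "closed D" "C \<inter> D = {}" "C \<union> D = K" "K \<inter> A \<subseteq> C" "K \<inter> B \<subseteq> D"
proof -
  have "separated_between (top_of_set K) (K \<inter> A) (K \<inter> B)"
  proof (rule cut_wire_fence_theorem)
    show "compact_space (top_of_set K)"
      using \<open>compact K\<close> by (simp add: compact_space_subtopology)
    show "Hausdorff_space (top_of_set K)"
      by (simp add: Hausdorff_space_subtopology)
    show "closedin (top_of_set K) (K \<inter> A)" "closedin (top_of_set K) (K \<inter> B)"
      using assms by (simp_all add: closedin_closed_Int)
    show "disjnt C (K \<inter> A) \<or> disjnt C (K \<inter> B)" if "connectedin (top_of_set K) C" for C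
      using nocon[of C] that by (auto simp: connectedin_subtopology disjnt_def)
  qed
  then obtain U V where UV: "openin (top_of_set K) U" "openin (top_of_set K) V"
      "U \<union> V = K" "disjnt U V" "K \<inter> A \<subseteq> U" "K \<inter> B \<subseteq> V"
    by (auto simp: separated_between_def)
  have "K - U = V" "K - V = U"
    using UV by (auto simp: disjnt_def)
  then have "closedin (top_of_set K) U" "closedin (top_of_set K) V"
    using closedin_diff[OF closedin_self UV(1)] closedin_diff[OF closedin_self UV(2)] by simp_all
  then have "closed U" "closed V"
    using closedin_closed_trans compact_imp_closed[OF \<open>compact K\<close>] by blast+
  with UV that show thesis
    by (auto simp: disjnt_def)
qed

lemma Int_closure_closedin:
  assumes "closedin (top_of_set U) S"
  shows "U \<inter> closure S = S"
proof -
  obtain F where "closed F" "S = U \<inter> F"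
    using assms by (auto simp: closedin_closed)
  then have "closure S \<subseteq> F"
    by (simp add: closure_minimal)
  with \<open>S = U \<inter> F\<close> show ?thesis
    using closure_subset[of S] by blast
qed

text \<open>A Urysohn function for the two pieces of \<open>K\<close>, enlarged by \<open>A\<close>
  and \<open>B\<close>, has a level set at 1/2 that separates \<open>A\<close> from \<open>B\<close>
  and misses \<open>K\<close> but may be disconnected. Unicoherence of the convex set
  \<open>X\<close> yields a connected subset of it that still separates.\<close>

lemma connected_separator:
  fixes X :: "'a::euclidean_space set"
  assumes X: "compact X" "convex X" and K: "closed K" "K \<subseteq> X"
    and A: "closed A" "connected A" "A \<subseteq> X" "A \<noteq> {}"
    and B: "closed B" "connected B" "B \<subseteq> X" "B \<noteq> {}"
    and "A \<inter> B = {}"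
    and nocon: "\<And>S. \<lbrakk>connected S; S \<subseteq> K; S \<inter> A \<noteq> {}\<rbrakk> \<Longrightarrow> S \<inter> B = {}"
  obtains T where "closed T" "connected T" "T \<subseteq> X - K"
    "\<And>S. \<lbrakk>connected S; S \<subseteq> X; S \<inter> A \<noteq> {}; S \<inter> B \<noteq> {}\<rbrakk> \<Longrightarrow> S \<inter> T \<noteq> {}"
proof -
  have "closed X"
    using X by (simp add: compact_imp_closed)
  have "compact K"
    using X K by (metis compact_Int_closed inf.absorb_iff2)
  obtain C D where CD: "closed C" "closed D" "C \<inter> D = {}" "C \<union> D = K" "K \<inter> A \<subseteq> C" "K \<inter> B \<subseteq> D"
    using \<open>compact K\<close> \<open>closed A\<close> \<open>closed B\<close> nocon by (rule compact_split_between)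
  \<comment> \<open>\<open>C\<close> can meet \<open>B\<close> only in \<open>K \<inter> B\<close>,
    which lies in \<open>D\<close>; likewise for \<open>D\<close> and \<open>A\<close>. So
    disjointness survives the enlargement.\<close>
  have "closed (C \<union> A)" "closed (D \<union> B)" "(C \<union> A) \<inter> (D \<union> B) = {}"
    using CD A B K \<open>A \<inter> B = {}\<close> by blast+
  then obtain f :: "'a \<Rightarrow> real" where f: "continuous_on UNIV f"
      "\<And>x. x \<in> C \<union> A \<Longrightarrow> f x = 0" "\<And>x. x \<in> D \<union> B \<Longrightarrow> f x = 1"
    by (rule Urysohn[where a = "0::real" and b = 1]) blast
  \<comment> \<open>P is the component of A in \<open>f < 1/2\<close> and Q the component of B in the complement of
    the closure of P. Both the closure of Q and \<open>X - Q\<close> are connected, so by unicoherence the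
    relative frontier T of Q is connected; it lies in the relative frontier of P, where
    \<open>f = 1/2\<close>, hence misses K.\<close>
  define W where "W = {x \<in> X. f x < 1/2}"
  have "W = X \<inter> {x. f x < 1/2}"
    by (auto simp: W_def)
  moreover have "open {x. f x < 1/2}"
    using f by (intro open_Collect_less) auto
  ultimately have opW: "openin (top_of_set X) W"
    by (simp add: openin_open_Int)
  have lcX: "locally connected X"
    using X by (simp add: convex_imp_locally_connected)
  have AW: "A \<subseteq> W"
    using f A by (auto simp: W_def)
  then obtain P where P: "P \<in> components W" "A \<subseteq> P"
    using A exists_component_superset[of A W] by auto
  have opP: "openin (top_of_set X) P"
    using lcX opW P unfolding locally_connected_open_component by blast
  have PX: "P \<subseteq> X"
    using opP openin_imp_subset by blast
  have "closure P \<subseteq> {x \<in> X. f x \<le> 1/2}"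
  proof (rule closure_minimal)
    show "P \<subseteq> {x \<in> X. f x \<le> 1/2}"
      using in_components_subset[OF P(1)] by (auto simp: W_def)
    have "closed {x. f x \<le> 1/2}"
      using f by (intro closed_Collect_le) auto
    then have "closed (X \<inter> {x. f x \<le> 1/2})"
      using \<open>closed X\<close> by blast
    then show "closed {x \<in> X. f x \<le> 1/2}"
      by (simp add: Collect_conj_eq)
  qed
  then have clP: "closure P \<subseteq> X" "\<And>x. x \<in> closure P \<Longrightarrow> f x \<le> 1/2"
    by auto
  define R where "R = X - closure P"
  have opR: "openin (top_of_set X) R"
    unfolding R_def Diff_eq by (intro openin_open_Int open_Compl closed_closure)
  have BR: "B \<subseteq> R"
    using B f(3) clP(2) by (force simp: R_def)
  then obtain Q where Q: "Q \<in> components R" "B \<subseteq> Q"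
    using B exists_component_superset[of B R] by auto
  have opQ: "openin (top_of_set X) Q"
    using lcX opR Q unfolding locally_connected_open_component by blast
  have QR: "Q \<subseteq> R"
    using Q in_components_subset by blast
  then have QX: "Q \<subseteq> X"
    by (auto simp: R_def)
  have clQ: "closure Q \<subseteq> X"
    using QX \<open>closed X\<close> by (simp add: closure_minimal)
  \<comment> \<open>Removing from a connected space one component of the complement of a connected
    set leaves a connected set.\<close>
  have cXQ: "connected (X - Q)"
  proof (rule component_diff_connected)
    show "connected (closure P)"
      using P in_components_connected connected_imp_connected_closure by blast
    show "connected X"
      using X by (simp add: convex_connected)
    show "Q \<in> components (X - closure P)"
      using Q by (simp add: R_def)
  qed (use clP in auto)
  have cldXQ: "closed (X - Q)"
    using opQ \<open>closed X\<close> closedin_closed_trans closedin_diff closedin_self by blast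
  define T where "T = closure Q \<inter> (X - Q)"
  show thesis
  proof
    show "closed T"
      unfolding T_def using cldXQ by blast
    show "connected T"
      unfolding T_def
    proof (rule unicoherentD)
      show "unicoherent X"
        using X by (simp add: convex_imp_unicoherent)
      show "connected (closure Q)"
        using Q in_components_connected connected_imp_connected_closure by blast
      show "closedin (top_of_set X) (closure Q)" "closedin (top_of_set X) (X - Q)"
        using clQ cldXQ by (auto simp: closed_subset)
      show "X = closure Q \<union> (X - Q)"
        using clQ closure_subset by blast
    qed (rule cXQ)
    have half: "f x = 1/2" if "x \<in> T" for x
    proof -
      have x: "x \<in> closure Q" "x \<in> X" "x \<notin> Q"
        using that by (auto simp: T_def)
      \<comment> \<open>\<open>Q\<close> is closed in \<open>R\<close>, so a point of
        \<open>closure Q\<close> outside \<open>Q\<close> cannot lie in \<open>R\<close>.\<close>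
      have "x \<in> closure P"
      proof (rule ccontr)
        assume "x \<notin> closure P"
        then have "x \<in> R"
          using x by (simp add: R_def)
        moreover have "R \<inter> closure Q = Q"
          using closedin_component[OF Q(1)] by (rule Int_closure_closedin)
        ultimately show False
          using x by blast
      qed
      \<comment> \<open>\<open>P\<close> is relatively open and disjoint from \<open>Q\<close>, so
        it contains no point of \<open>closure Q\<close>.\<close>
      moreover have "x \<notin> P"
      proof
        assume "x \<in> P"
        obtain G where G: "open G" "P = X \<inter> G"
          using opP by (auto simp: openin_open)
        then have "G \<inter> Q \<noteq> {}"
          using x \<open>x \<in> P\<close> open_Int_closure_eq_empty[of G Q] by blast
        then have "P \<inter> Q \<noteq> {}"
          using G QX by blast
        then show False
          using QR closure_subset[of P] by (auto simp: R_def)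
      qed
      \<comment> \<open>\<open>P\<close> is closed in \<open>W\<close>, so a point of
        \<open>closure P\<close> outside \<open>P\<close> leaves \<open>W\<close>, which forces
        \<open>f\<close> to be at least 1/2 there.\<close>
      moreover have "W \<inter> closure P = P"
        using closedin_component[OF P(1)] by (rule Int_closure_closedin)
      ultimately have "x \<notin> W"
        by blast
      then show ?thesis
        using clP(2) \<open>x \<in> closure P\<close> x by (force simp: W_def)
    qed
    \<comment> \<open>On \<open>K\<close>, the union of \<open>C\<close> and \<open>D\<close>, the
      only values of \<open>f\<close> are 0 and 1.\<close>
    then show "T \<subseteq> X - K"
      using f(2,3) CD(4) by (force simp: T_def)
    show "S \<inter> T \<noteq> {}" if "connected S" "S \<subseteq> X" "S \<inter> A \<noteq> {}" "S \<inter> B \<noteq> {}" for S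
    proof
      assume "S \<inter> T = {}"
      then have "closure Q \<inter> (X - Q) \<inter> S = {}"
        by (auto simp: T_def)
      moreover have "S \<subseteq> closure Q \<union> (X - Q)"
        using that closure_subset by blast
      \<comment> \<open>Two closed sets cover \<open>S\<close> and are disjoint on it, so
        connectedness makes \<open>S\<close> miss one of them; yet \<open>S\<close> meets
        \<open>B\<close> inside \<open>Q\<close> and \<open>A\<close> outside
        \<open>Q\<close>.\<close>
      ultimately have "closure Q \<inter> S = {} \<or> (X - Q) \<inter> S = {}"
        using connected_closedD[OF \<open>connected S\<close>] cldXQ closed_closure by metis
      moreover have "closure Q \<inter> S \<noteq> {}"
        using that Q closure_subset by blast
      moreover have "A \<inter> Q = {}"
        using P QR closure_subset[of P] by (auto simp: R_def)
      ultimately show False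
        using that A by blast
    qed
  qed
qed

section \<open>Faces of the cube and sets connecting them\<close>

lemma unit_cube_props:
  "compact (unit_cube :: (real^'n) set)" "convex (unit_cube :: (real^'n) set)"
  by (simp_all add: unit_cube_def)

lemma face_eq:
  "face_minus i = unit_cube \<inter> {z. z $ i = 0}"
  "face_plus i = unit_cube \<inter> {z. z $ i = 1}"
  unfolding face_minus_def face_plus_def by blast+

lemma face_props:
  fixes i :: "'n::finite"
  shows "closed (face_minus i)" "closed (face_plus i)"
    "connected (face_minus i)" "connected (face_plus i)"
    "0 \<in> face_minus i" "1 \<in> face_plus i" "face_minus i \<subseteq> unit_cube" "face_plus i \<subseteq> unit_cube"
    "face_minus i \<inter> face_plus i = {}"
proof -
  have hyp: "convex {z::real^'n. z $ i = c}" "closed {z::real^'n. z $ i = c}" for c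
    using convex_hyperplane[of "axis i (1::real)" c] closed_hyperplane[of "axis i (1::real)" c]
    by (simp_all add: inner_axis')
  show "closed (face_minus i)" "closed (face_plus i)"
    unfolding face_eq by (rule closed_Int[OF compact_imp_closed[OF unit_cube_props(1)] hyp(2)])+
  show "connected (face_minus i)" "connected (face_plus i)"
    unfolding face_eq by (rule convex_connected[OF convex_Int[OF unit_cube_props(2) hyp(1)]])+
  show "0 \<in> face_minus i" "1 \<in> face_plus i"
    by (simp_all add: face_minus_def face_plus_def unit_cube_def mem_box_cart)
  show "face_minus i \<subseteq> unit_cube" "face_plus i \<subseteq> unit_cube" "face_minus i \<inter> face_plus i = {}"
    by (auto simp: face_minus_def face_plus_def)
qed

lemma connects_faces_mono: "\<lbrakk>connects_faces i A; A \<subseteq> B\<rbrakk> \<Longrightarrow> connects_faces i B"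
  unfolding connects_faces_def by blast

lemma connects_faces_unit_cube: "connects_faces i unit_cube"
  unfolding connects_faces_def
proof (intro exI conjI)
  show "connected unit_cube"
    using unit_cube_props(2) by (rule convex_connected)
  show "unit_cube \<inter> face_minus i \<noteq> {}" "unit_cube \<inter> face_plus i \<noteq> {}"
    using face_props(5-8)[of i] by blast+
qed simp

text \<open>Relatively open subsets of the cube are locally path connected, so a connected set
  joining the faces can be replaced by a path, whose image is compact.\<close>

lemma connects_faces_imp_compact:
  assumes "openin (top_of_set unit_cube) A" "connects_faces i A"
  shows "\<exists>C\<subseteq>A. compact C \<and> connects_faces i C"
proof -
  obtain S x y where S: "S \<subseteq> A" "connected S" "x \<in> S" "x \<in> face_minus i" "y \<in> S" "y \<in> face_plus i"
    using assms(2) unfolding connects_faces_def by blast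
  have "locally path_connected A"
    using assms(1) unit_cube_props(2) convex_imp_locally_path_connected locally_open_subset by blast
  moreover have "connected_component A x y"
    using S by (auto simp: connected_component_def)
  ultimately have "path_component A x y"
    by (simp add: path_component_eq_connected_component)
  then obtain \<gamma> where \<gamma>: "path \<gamma>" "path_image \<gamma> \<subseteq> A" "pathstart \<gamma> = x" "pathfinish \<gamma> = y"
    by (auto simp: path_component_def)
  moreover have "connects_faces i (path_image \<gamma>)"
    unfolding connects_faces_def using \<gamma> S pathstart_in_path_image[of \<gamma>] pathfinish_in_path_image[of \<gamma>] by blast
  ultimately show ?thesis
    using compact_path_image by blast
qed

section \<open>Thresholds for superlevel and sublevel sets\<close>

text \<open>The set \<open>U\<close> of connecting levels is nonempty, bounded above, downward
  closed and without a maximum, hence the open ray below its supremum.\<close>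

lemma connects_superlevel_threshold:
  fixes g :: "real ^ 'n \<Rightarrow> real"
  assumes g: "continuous_on unit_cube g"
  obtains a where "\<And>p. connects_faces i {z \<in> unit_cube. p < g z} \<longleftrightarrow> p < a"
proof -
  define U where "U = {p. connects_faces i {z \<in> unit_cube. p < g z}}"
  obtain L where L: "\<And>z. z \<in> unit_cube \<Longrightarrow> \<bar>g z\<bar> \<le> L"
    using compact_imp_bounded[OF compact_continuous_image[OF g unit_cube_props(1)]]
    by (auto simp: bounded_iff)
  \<comment> \<open>The level \<open>- L - 1\<close> lies strictly below every value of
    \<open>g\<close> on the cube.\<close>
  have "{z \<in> unit_cube. - L - 1 < g z} = unit_cube"
    using L by force
  then have "- L - 1 \<in> U"
    using connects_faces_unit_cube[of i] by (simp add: U_def)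
  then have "U \<noteq> {}"
    by blast
  have "p \<le> L" if p: "p \<in> U" for p
  proof -
    obtain z where "z \<in> unit_cube" "p < g z"
      using p unfolding U_def connects_faces_def by blast
    then show ?thesis
      using L[of z] by linarith
  qed
  then have "bdd_above U"
    by (meson bdd_aboveI)
  have down: "q \<in> U" if "p \<in> U" "q \<le> p" for p q
    using that by (auto simp: U_def elim!: connects_faces_mono)
  \<comment> \<open>On a compact connecting set \<open>C\<close> the minimum of \<open>g\<close>
    exceeds \<open>p\<close>, so every level strictly between them still has \<open>C\<close> in its
    superlevel set.\<close>
  have up: "\<exists>q\<in>U. p < q" if p: "p \<in> U" for p
  proof -
    have "openin (top_of_set unit_cube) (unit_cube \<inter> g -` {p<..})"
      using g by (intro continuous_openin_preimage_gen) auto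
    then have "openin (top_of_set unit_cube) {z \<in> unit_cube. p < g z}"
      by (simp add: vimage_def Collect_conj_eq)
    then obtain C where C: "C \<subseteq> {z \<in> unit_cube. p < g z}" "compact C" "connects_faces i C"
      using connects_faces_imp_compact p unfolding U_def by blast
    then have "C \<noteq> {}"
      by (auto simp: connects_faces_def)
    moreover have "continuous_on C g"
      using g C by (auto elim: continuous_on_subset)
    ultimately obtain m where m: "m \<in> C" "\<And>z. z \<in> C \<Longrightarrow> g m \<le> g z"
      using \<open>compact C\<close> continuous_attains_inf by metis
    obtain q where q: "p < q" "q < g m"
      using m C dense by blast
    then have "C \<subseteq> {z \<in> unit_cube. q < g z}"
      using m C by force
    then have "q \<in> U"
      using C connects_faces_mono by (auto simp: U_def)
    with q show ?thesis by blast
  qed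
  have "p \<in> U \<longleftrightarrow> p < Sup U" for p
  proof
    assume "p \<in> U"
    then show "p < Sup U"
      using up \<open>bdd_above U\<close> by (meson cSup_upper less_le_trans)
  next
    assume "p < Sup U"
    then show "p \<in> U"
      using \<open>U \<noteq> {}\<close> down less_cSupD less_imp_le by metis
  qed
  then have "connects_faces i {z \<in> unit_cube. p < g z} \<longleftrightarrow> p < Sup U" for p
    unfolding U_def mem_Collect_eq .
  then show thesis
    by (rule that)
qed

text \<open>Sublevel sets of \<open>g\<close> are superlevel sets of \<open>- g\<close> at the
  negated level.\<close>

lemma connects_sublevel_threshold:
  fixes g :: "real ^ 'n \<Rightarrow> real"
  assumes "continuous_on unit_cube g"
  obtains b where "\<And>p. connects_faces i {z \<in> unit_cube. g z < p} \<longleftrightarrow> b < p"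
proof -
  have "continuous_on unit_cube (\<lambda>z. - g z)"
    using assms by (rule continuous_on_minus)
  then obtain a where a: "\<And>p. connects_faces i {z \<in> unit_cube. p < - g z} \<longleftrightarrow> p < a"
    by (rule connects_superlevel_threshold[of _ i]) blast
  have "connects_faces i {z \<in> unit_cube. g z < p} \<longleftrightarrow> - a < p" for p
    using a[of "- p"] by (simp add: minus_less_iff)
  then show thesis
    by (rule that)
qed

section \<open>Fibres and their complements\<close>

text \<open>The image under \<open>g\<close> of a connected set that avoids the fibre is an interval
  omitting \<open>p\<close>, so it lies on one side of \<open>p\<close>.\<close>

lemma connects_faces_avoiding_fibre:
  assumes "continuous_on unit_cube g"
  shows "connects_faces i (unit_cube - fibre g p) \<longleftrightarrow>
    connects_faces i {z \<in> unit_cube. p < g z} \<or> connects_faces i {z \<in> unit_cube. g z < p}"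
    (is "?L \<longleftrightarrow> ?R")
proof
  assume ?L
  then obtain S where S: "S \<subseteq> unit_cube - fibre g p" "connected S"
      "S \<inter> face_minus i \<noteq> {}" "S \<inter> face_plus i \<noteq> {}"
    by (auto simp: connects_faces_def)
  have "connected (g ` S)"
    using S assms by (meson Diff_subset connected_continuous_image continuous_on_subset order_trans)
  moreover have "p \<notin> g ` S"
    using S by (auto simp: fibre_def)
  ultimately have "(\<forall>z\<in>S. p < g z) \<or> (\<forall>z\<in>S. g z < p)"
    by (meson connected_iff_interval imageI linorder_not_less order_less_imp_le)
  then have "S \<subseteq> {z \<in> unit_cube. p < g z} \<or> S \<subseteq> {z \<in> unit_cube. g z < p}"
    using S by auto
  then show ?R
    using S unfolding connects_faces_def by blast
next
  assume ?R
  then show ?L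
    by (rule disjE) (auto simp: fibre_def elim!: connects_faces_mono)
qed

text \<open>The level \<open>q\<close> is the maximum or the minimum of \<open>g\<close> on a
  compact connected separator \<open>T\<close>. It differs from \<open>p\<close> because the
  extremum is attained off the fibre; this strict gap later excludes \<open>p\<close> from the
  closed interval between the thresholds.\<close>

lemma not_connects_fibre_imp:
  fixes g :: "real ^ 'n \<Rightarrow> real"
  assumes g: "continuous_on unit_cube g" and ncon: "\<not> connects_faces i (fibre g p)"
  shows "(\<exists>q<p. \<not> connects_faces i {z \<in> unit_cube. q < g z}) \<or>
         (\<exists>q>p. \<not> connects_faces i {z \<in> unit_cube. g z < q})"
proof -
  have clK: "closed (fibre g p)"
  proof -
    have "closed (unit_cube \<inter> g -` {p})"
      using g unit_cube_props(1) by (intro continuous_closed_preimage) (auto intro: compact_imp_closed)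
    then show ?thesis
      by (simp add: fibre_def vimage_def Collect_conj_eq)
  qed
  obtain T where T: "closed T" "connected T" "T \<subseteq> unit_cube - fibre g p"
    "\<And>S. \<lbrakk>connected S; S \<subseteq> unit_cube; S \<inter> face_minus i \<noteq> {}; S \<inter> face_plus i \<noteq> {}\<rbrakk> \<Longrightarrow> S \<inter> T \<noteq> {}"
  proof (rule connected_separator[of unit_cube "fibre g p" "face_minus i" "face_plus i"])
    show "S \<inter> face_plus i = {}"
      if "connected S" "S \<subseteq> fibre g p" "S \<inter> face_minus i \<noteq> {}" for S
      using that ncon by (auto simp: connects_faces_def)
    show "face_minus i \<noteq> {}" "face_plus i \<noteq> {}"
      using face_props(5,6)[of i] by auto
    show "fibre g p \<subseteq> unit_cube"
      by (auto simp: fibre_def)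
  qed (use clK unit_cube_props face_props[of i] in simp_all)
  have hit: "A \<inter> T \<noteq> {}" if "connects_faces i A" "A \<subseteq> unit_cube" for A
  proof -
    obtain S where S: "S \<subseteq> A" "connected S" "S \<inter> face_minus i \<noteq> {}" "S \<inter> face_plus i \<noteq> {}"
      using \<open>connects_faces i A\<close> by (auto simp: connects_faces_def)
    then have "S \<inter> T \<noteq> {}"
      using T(4)[of S] \<open>A \<subseteq> unit_cube\<close> by simp
    with S show ?thesis
      by blast
  qed
  have "T \<noteq> {}"
    using hit[OF connects_faces_unit_cube] by auto
  have "T \<subseteq> unit_cube"
    using T by blast
  then have gT: "continuous_on T g"
    using g continuous_on_subset by blast
  have "compact T"
    using compact_Int_closed[OF unit_cube_props(1) \<open>closed T\<close>] \<open>T \<subseteq> unit_cube\<close>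
    by (simp add: inf.absorb2)
  obtain l where l: "l \<in> T" "\<And>z. z \<in> T \<Longrightarrow> g l \<le> g z"
    using \<open>compact T\<close> \<open>T \<noteq> {}\<close> gT continuous_attains_inf by metis
  obtain u where u: "u \<in> T" "\<And>z. z \<in> T \<Longrightarrow> g z \<le> g u"
    using \<open>compact T\<close> \<open>T \<noteq> {}\<close> gT continuous_attains_sup by metis
  have "connected (g ` T)"
    using gT T by (intro connected_continuous_image)
  moreover have "p \<notin> g ` T"
    using T by (auto simp: fibre_def)
  ultimately consider "g u < p" | "p < g l"
    using l u by (meson connected_iff_interval imageI linorder_not_less)
  then show ?thesis
  proof cases
    case 1
    \<comment> \<open>As \<open>g u\<close> is the maximum on \<open>T\<close>, this superlevel set
      misses \<open>T\<close>, whereas every connecting subset of the cube meets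
      \<open>T\<close>.\<close>
    have "\<not> connects_faces i {z \<in> unit_cube. g u < g z}"
      using hit[of "{z \<in> unit_cube. g u < g z}"] u by force
    with 1 show ?thesis by blast
  next
    case 2
    have "\<not> connects_faces i {z \<in> unit_cube. g z < g l}"
      using hit[of "{z \<in> unit_cube. g z < g l}"] l by force
    with 2 show ?thesis by blast
  qed
qed

lemma Sep_Conn_intervals:
  fixes g :: "real ^ 'n \<Rightarrow> real"
  assumes g: "continuous_on unit_cube g"
  obtains a b where "Sep i g = {a..b}" "Conn i g = {b..a}"
proof -
  obtain a where a: "\<And>p. connects_faces i {z \<in> unit_cube. p < g z} \<longleftrightarrow> p < a"
    using connects_superlevel_threshold[OF g, of i] by blast
  obtain b where b: "\<And>p. connects_faces i {z \<in> unit_cube. g z < p} \<longleftrightarrow> b < p"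
    using connects_sublevel_threshold[OF g, of i] by blast
  have "Sep i g = {a..b}"
    using a b by (auto simp: Sep_def separates_faces_def connects_faces_avoiding_fibre[OF g] not_less)
  moreover have "Conn i g = {b..a}"
  proof (intro set_eqI iffI)
    fix p assume "p \<in> Conn i g"
    then have "connects_faces i (fibre g p)"
      by (simp add: Conn_def)
    \<comment> \<open>The fibre over \<open>p\<close> lies in the superlevel set of each lower
      level; density of the reals then gives \<open>p \<le> a\<close>.\<close>
    then have "q < a" if "q < p" for q
      using that by (auto simp: fibre_def a[symmetric] elim!: connects_faces_mono)
    moreover have "b < q" if "p < q" for q
      using that \<open>connects_faces i (fibre g p)\<close> by (auto simp: fibre_def b[symmetric] elim!: connects_faces_mono)
    ultimately show "p \<in> {b..a}"
      by (auto intro: dense_le dense_ge less_imp_le)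
  next
    fix p assume p: "p \<in> {b..a}"
    show "p \<in> Conn i g"
    proof (rule ccontr)
      assume "p \<notin> Conn i g"
      \<comment> \<open>A non-connecting fibre would give \<open>a \<le> q < p\<close> or
        \<open>p < q \<le> b\<close>.\<close>
      then show False
        using not_connects_fibre_imp[OF g, of i p] p by (auto simp: Conn_def a b)
    qed
  qed
  ultimately show thesis
    by (rule that)
qed

text \<open>A nondegenerate real interval is infinite and gets the default cardinality 0, as does
  the empty one, so the value 1 singles out a point.\<close>

lemma card_real_Icc_eq_1: "card {a..b::real} = 1 \<longleftrightarrow> a = b"
  by (cases a b rule: linorder_cases) auto

lemma compact_interval_Icc: "compact_interval {a..b} \<longleftrightarrow> a < b"
  by (auto simp: compact_interval_def)

theorem corollary5p14:
  fixes g :: "real ^ 'n \<Rightarrow> real" and i :: 'n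
  assumes "continuous_on unit_cube g"
  shows "(Sep i g = {} \<longleftrightarrow> compact_interval (Conn i g)) \<and>
         (Conn i g = {} \<longleftrightarrow> compact_interval (Sep i g)) \<and>
         (card (Sep i g) = 1 \<longleftrightarrow> card (Conn i g) = 1) \<and>
         (card (Conn i g) = 1 \<longleftrightarrow> Sep i g = Conn i g)"
proof -
  obtain a b where ab: "Sep i g = {a..b}" "Conn i g = {b..a}"
    using Sep_Conn_intervals[OF assms] by blast
  \<comment> \<open>If \<open>a \<noteq> b\<close>, exactly one of the two intervals is empty and
    the other is nondegenerate; if \<open>a = b\<close>, both are the same singleton.\<close>
  show ?thesis
    unfolding ab compact_interval_Icc card_real_Icc_eq_1 by auto
qed

end
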